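(* Let $G$ and $H$ be finite simple graphs of the same order $n$ that are noncospectral singularly cospectral, i.e. their adjacency matrices $A(G)$ and $A(H)$ have the same multiset of singular values but different multisets of eigenvalues. Then there exists an even integer $d\geq 6$ such that $\|G\|_d\neq\|H\|_d$.
   Context: For a finite simple graph $G$ of order $n$ with vertices $v_1,\dots,v_n$, the adjacency matrix $A(G)$ is the $n\times n$ matrix with $[A(G)]_{ij}=1$ if $v_i,v_j$ are joined by an edge and $0$ otherwise; its eigenvalues $\lambda_1\geq\cdots\geq\lambda_n$ are real. The complete homogeneous symmetric (CHS) polynomial of degree $d$ is $h_d(x_1,\dots,x_n)=\sum_{1\leq i_1\leq\cdots\leq i_d\leq n}x_{i_1}\cdots x_{i_d}$. For even $d\geq 2$, the CHS $d$-norm of $G$ is $\|G\|_d=\big(h_d(\lambda_1,\dots,\lambda_n)\big)^{1/d}$. *)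

theory Defs
  imports
    "Graph_Theory.Pair_Digraph"
    "Jordan_Normal_Form.Char_Poly"
begin

text \<open>
  A finite simple graph is an instance of \<^locale>\<open>pair_graph\<close>: a finite, symmetric, loopfree set
  of ordered pairs over a finite vertex set, each undirected edge being represented by
  its two orientations. An enumeration of the vertices is given by a list.
\<close>

definition vertex_enum :: "'a pair_pre_digraph \<Rightarrow> 'a list \<Rightarrow> bool" where
  "vertex_enum G vs \<longleftrightarrow> distinct vs \<and> set vs = pverts G"

definition adjacency_matrix :: "'a pair_pre_digraph \<Rightarrow> 'a list \<Rightarrow> real mat" where
  "adjacency_matrix G vs =
     mat (length vs) (length vs) (\<lambda>(i, j). if (vs ! i, vs ! j) \<in> parcs G then 1 else 0)"

text \<open>
  The real eigenvalues with algebraic multiplicity. For symmetric matrices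
  these are all the eigenvalues, see \<open>size_eigenvalues_mset\<close> below.
\<close>

definition eigenvalues_mset :: "real mat \<Rightarrow> real multiset" where
  "eigenvalues_mset A = proots (char_poly A)"

definition singular_values_mset :: "real mat \<Rightarrow> real multiset" where
  "singular_values_mset A = image_mset sqrt (eigenvalues_mset (transpose_mat A * A))"

definition cospectral :: "real mat \<Rightarrow> real mat \<Rightarrow> bool" where
  "cospectral A B \<longleftrightarrow> eigenvalues_mset A = eigenvalues_mset B"

definition singularly_cospectral :: "real mat \<Rightarrow> real mat \<Rightarrow> bool" where
  "singularly_cospectral A B \<longleftrightarrow> singular_values_mset A = singular_values_mset B"

definition chs :: "nat \<Rightarrow> real list \<Rightarrow> real" where
  "chs d xs =
     (\<Sum>is | length is = d \<and> sorted is \<and> set is \<subseteq> {..<length xs}. \<Prod>i\<leftarrow>is. xs ! i)"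

definition eigenvalues_list :: "real mat \<Rightarrow> real list" where
  "eigenvalues_list A = rev (sorted_list_of_multiset (eigenvalues_mset A))"

definition chs_norm :: "nat \<Rightarrow> 'a pair_pre_digraph \<Rightarrow> 'a list \<Rightarrow> real" where
  "chs_norm d G vs = root d (chs d (eigenvalues_list (adjacency_matrix G vs)))"

lemma hermitian_eigenvalue_real:
  fixes A :: "real mat" and k :: complex
  assumes A: "A \<in> carrier_mat n n" and sym: "transpose_mat A = A"
    and ev: "eigenvalue (map_mat complex_of_real A) k"
  shows "k \<in> \<real>"
proof -
  let ?A = "map_mat complex_of_real A"
  have A': "?A \<in> carrier_mat n n" using A by simp
  obtain v where v: "v \<in> carrier_vec n" "v \<noteq> 0\<^sub>v n" and Av: "?A *\<^sub>v v = k \<cdot>\<^sub>v v"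
    using ev A unfolding eigenvalue_def eigenvector_def by auto
  have cj: "conjugate (?A *\<^sub>v v) = ?A *\<^sub>v conjugate v"
  proof (rule eq_vecI)
    fix i assume i: "i < dim_vec (?A *\<^sub>v conjugate v)"
    hence "i < n" using A by simp
    thus "conjugate (?A *\<^sub>v v) $ i = (?A *\<^sub>v conjugate v) $ i"
      using A v by (simp add: scalar_prod_def)
  qed (use A in auto)
  have "k * (v \<bullet>c v) = (?A *\<^sub>v v) \<bullet>c v"
    unfolding Av using v by simp
  also have "\<dots> = v \<bullet> (transpose_mat ?A *\<^sub>v conjugate v)"
    using transpose_vec_mult_scalar[of "transpose_mat ?A" n n "conjugate v" v] A' v
    by (metis conjugate_id carrier_vec_conjugate transpose_carrier_mat transpose_transpose
        transpose_vec_mult_scalar comm_scalar_prod mult_mat_vec_carrier)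
  also have "transpose_mat ?A = ?A"
    using sym by (simp add: map_mat_transpose)
  also have "v \<bullet> (?A *\<^sub>v conjugate v) = v \<bullet>c (k \<cdot>\<^sub>v v)"
    unfolding cj[symmetric] Av ..
  also have "\<dots> = cnj k * (v \<bullet>c v)"
    using v by (simp add: conjugate_smult_vec)
  finally have "k = cnj k"
    using v by (simp add: conjugate_square_eq_0_vec)
  thus ?thesis by (metis Reals_cnj_iff)
qed

lemma size_eigenvalues_mset:
  assumes A: "A \<in> carrier_mat n n" and sym: "transpose_mat A = A"
  shows "size (eigenvalues_mset A) = n"
proof -
  let ?A = "map_mat complex_of_real A"
  have A': "?A \<in> carrier_mat n n" using A by simp
  obtain es where es: "char_poly ?A = (\<Prod>e\<leftarrow>es. [:- e, 1:])" and len: "length es = n"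
    using char_poly_factorized[OF A'] by blast
  have real: "e \<in> \<real>" if "e \<in> set es" for e
  proof (rule hermitian_eigenvalue_real[OF A sym])
    show "eigenvalue ?A e"
      using that
      by (simp add: eigenvalue_root_char_poly[OF A'] es poly_prod_list prod_list_zero_iff image_iff)
  qed
  define rs where "rs = map Re es"
  have es_rs: "es = map complex_of_real rs"
    unfolding rs_def using real by (induction es) auto
  have "map_poly complex_of_real (char_poly A) = char_poly ?A"
    by (rule of_real_hom.char_poly_hom[OF A, symmetric])
  also have "\<dots> = map_poly complex_of_real (\<Prod>r\<leftarrow>rs. [:- r, 1:])"
    unfolding es es_rs
    by (induction rs) (auto simp: coeff_map_poly coeff_pCons intro!: poly_eqI split: nat.splits)
  finally have "char_poly A = (\<Prod>r\<leftarrow>rs. [:- r, 1:])"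
    by (simp add: poly_eq_iff coeff_map_poly)
  moreover have "proots (\<Prod>r\<leftarrow>rs. [:- r, 1:]) = mset rs"
  proof (induction rs)
    case (Cons r rs)
    have "proots ([:- r, 1:] * (\<Prod>r\<leftarrow>rs. [:- r, 1:])) = {#r#} + mset rs"
      by (subst proots_mult) (auto simp: prod_list_zero_iff Cons.IH simp del: mult_pCons_left)
    thus ?case by (simp del: mult_pCons_left)
  qed simp
  ultimately show ?thesis
    using len by (simp add: eigenvalues_mset_def rs_def)
qed

end

theory Submission
  imports
    Defs
    "Jordan_Normal_Form.Schur_Decomposition"
    "HOL-Computational_Algebra.Polynomial_FPS"
begin

text \<open>
  Let \<open>P\<close> and \<open>Q\<close> be the products of the factors \<open>1 - \<lambda> t\<close> over the eigenvalues of the two graphs, so that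
  \<open>1 / P\<close> and \<open>1 / Q\<close> generate the polynomials \<open>h\<^sub>d\<close>. Equality of the singular values means
  \<open>P(t) P(-t) = Q(t) Q(-t)\<close>. If the even norms agreed, so would the even parts of \<open>1 / P\<close> and \<open>1 / Q\<close>, hence
  \<open>P(t) + P(-t) = Q(t) + Q(-t)\<close>. Then \<open>P(t)\<close> is \<open>Q(t)\<close> or \<open>Q(-t)\<close>. The first is excluded by
  noncospectrality. In the second case the spectra are negatives of each other, so the odd power sums
  are opposite; being traces of powers of nonnegative matrices, they vanish. Thus all power sums
  agree, and the graphs are cospectral after all.
\<close>

section \<open>Complete homogeneous symmetric polynomials\<close>

text \<open>The reversed characteristic polynomial det(I - tA) when \<open>xs\<close> lists the
  spectrum of A. Zero entries contribute the factor 1 and so are invisible in it.\<close>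

definition recip_poly :: "real list \<Rightarrow> real poly" where
  "recip_poly xs = (\<Prod>x\<leftarrow>xs. [:1, -x:])"

lemma recip_poly_Nil [simp]: "recip_poly [] = 1"
  by (simp add: recip_poly_def)

lemma recip_poly_Cons: "recip_poly (x # xs) = [:1, -x:] * recip_poly xs"
  by (simp add: recip_poly_def)

lemma coeff_0_recip_poly [simp]: "coeff (recip_poly xs) 0 = 1"
  by (induction xs) (simp_all add: recip_poly_Cons coeff_mult)

lemma recip_poly_nonzero [simp]: "recip_poly xs \<noteq> 0"
  using coeff_0_recip_poly[of xs] by (metis coeff_0 zero_neq_one)

text \<open>The degree counts the nonzero entries.\<close>

lemma degree_recip_poly_uminus: "degree (recip_poly (map uminus xs)) = degree (recip_poly xs)"
proof (induction xs)
  case (Cons x xs)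
  have "degree (recip_poly (y # ys)) = (if y = 0 then 0 else 1) + degree (recip_poly ys)" for y ys
    unfolding recip_poly_Cons by (subst degree_mult_eq) auto
  thus ?case using Cons by simp
qed simp

text \<open>Each pair of factors gives (1 - xt)(1 + xt) = 1 - x^2 t^2, so the product depends only
  on the absolute values; for the spectrum of a symmetric matrix these are the singular
  values.\<close>

lemma recip_poly_mult_uminus:
  "recip_poly xs * recip_poly (map uminus xs) = (\<Prod>x\<in>#image_mset abs (mset xs). [:1, 0, -(x\<^sup>2):])"
proof (induction xs)
  case (Cons x xs)
  have "recip_poly (x # xs) * recip_poly (map uminus (x # xs))
      = ([:1, -x:] * [:1, x:]) * (recip_poly xs * recip_poly (map uminus xs))"
    by (simp only: recip_poly_Cons list.map minus_minus mult_ac)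
  also have "[:1, -x:] * [:1, x:] = [:1, 0, -(\<bar>x\<bar>\<^sup>2):]"
    by (simp add: power2_eq_square)
  finally show ?case using Cons by simp
qed simp

lemma proots_recip_poly: "proots (recip_poly xs) = image_mset inverse (filter_mset (\<lambda>x. x \<noteq> 0) (mset xs))"
proof (induction xs)
  case (Cons x xs)
  have "proots [:1, -x:] = {#inverse x#}" if "x \<noteq> 0"
  proof -
    have "[:1, -x:] = Polynomial.smult (-x) [:- inverse x, 1:]" using that by simp
    thus ?thesis using that by (metis neg_equal_0_iff_equal proots_linear_factor proots_smult minus_minus)
  qed
  thus ?case unfolding recip_poly_Cons
    by (subst proots_mult) (auto simp: Cons.IH)
qed simp

text \<open>The roots are the inverses of the nonzero entries, which are thereby recovered; the
  length then fixes the number of zeros.\<close>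

lemma recip_poly_inject:
  assumes "length xs = length ys" and "recip_poly xs = recip_poly ys"
  shows "mset xs = mset ys"
proof -
  let ?nz = "\<lambda>zs. filter_mset (\<lambda>x. x \<noteq> 0) (mset zs)"
  have nz: "?nz zs = image_mset inverse (proots (recip_poly zs))" for zs :: "real list"
    by (simp add: proots_recip_poly multiset.map_comp o_def)
  have zeros: "filter_mset (\<lambda>x. \<not> x \<noteq> 0) (mset zs) = replicate_mset (length zs - size (?nz zs)) 0"
    for zs :: "real list"
    by (induction zs) (auto simp: Suc_diff_le size_mset[symmetric] simp del: size_mset intro: size_filter_mset_lesseq)
  show ?thesis
    using multiset_partition[of "mset xs" "\<lambda>x. x \<noteq> 0"] multiset_partition[of "mset ys" "\<lambda>x. x \<noteq> 0"]
    unfolding zeros nz assms by simp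
qed

section \<open>Recurrence and generating function of the CHS polynomials\<close>

lemma chs_0 [simp]: "chs 0 xs = 1"
proof -
  have "{is. length is = 0 \<and> sorted is \<and> set is \<subseteq> {..<length xs}} = {[]}" by auto
  thus ?thesis by (simp add: chs_def)
qed

lemma chs_Suc_Nil [simp]: "chs (Suc d) [] = 0"
proof -
  have "{is. length is = Suc d \<and> sorted is \<and> set is \<subseteq> {..<length ([]::real list)}} = {}" by auto
  thus ?thesis unfolding chs_def by (simp only: sum.empty)
qed

lemma finite_chs_index: "finite {is. length is = d \<and> sorted is \<and> set is \<subseteq> {..<n::nat}}"
  by (rule finite_subset[OF _ finite_lists_length_eq[of "{..<n}" d]]) auto

text \<open>Monomials are split by whether they contain \<open>x\<close>: a sorted index list either
  starts with 0, or avoids 0 and is a shifted index list for \<open>xs\<close>.\<close>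

lemma chs_Suc_Cons: "chs (Suc d) (x # xs) = x * chs d (x # xs) + chs (Suc d) xs"
proof -
  let ?I = "\<lambda>d n. {is. length is = d \<and> sorted is \<and> set is \<subseteq> {..<n::nat}}"
  let ?n = "length xs"
  let ?f = "\<lambda>is. \<Prod>i\<leftarrow>is. (x # xs) ! i"
  have split: "?I (Suc d) (Suc ?n) = Cons 0 ` ?I d (Suc ?n) \<union> map Suc ` ?I (Suc d) ?n"
  proof (intro equalityI subsetI)
    fix js assume js: "js \<in> ?I (Suc d) (Suc ?n)"
    then obtain i ks where i: "js = i # ks" by (cases js) auto
    show "js \<in> Cons 0 ` ?I d (Suc ?n) \<union> map Suc ` ?I (Suc d) ?n"
    proof (cases i)
      case 0
      thus ?thesis using js i by auto
    next
      case (Suc k)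
      \<comment> \<open>The head of a sorted list is its least entry, so every index is positive and
        can be lowered by one.\<close>
      have pos: "\<forall>j\<in>set js. 0 < j" using js i Suc by auto
      hence eq: "js = map Suc (map (\<lambda>j. j - 1) js)"
        by (simp add: map_idI)
      have "sorted (map (\<lambda>j. j - 1) js)"
        using js by (auto simp: sorted_map intro: sorted_wrt_mono_rel[of js "(\<le>)"])
      moreover have "set (map (\<lambda>j. j - 1) js) \<subseteq> {..<?n}"
        using js pos by fastforce
      ultimately have "map (\<lambda>j. j - 1) js \<in> ?I (Suc d) ?n" using js by simp
      thus ?thesis using eq by blast
    qed
  next
    fix js assume "js \<in> Cons 0 ` ?I d (Suc ?n) \<union> map Suc ` ?I (Suc d) ?n"
    thus "js \<in> ?I (Suc d) (Suc ?n)"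
      by (fastforce simp: sorted_map)
  qed
  have disj: "Cons 0 ` ?I d (Suc ?n) \<inter> map Suc ` ?I (Suc d) ?n = {}"
    by auto
  have "chs (Suc d) (x # xs) = sum ?f (Cons 0 ` ?I d (Suc ?n)) + sum ?f (map Suc ` ?I (Suc d) ?n)"
    unfolding chs_def list.size(4) add_0_right add_Suc_right split
    by (rule sum.union_disjoint[OF _ _ disj]) (intro finite_imageI finite_chs_index)+
  also have "sum ?f (Cons 0 ` ?I d (Suc ?n)) = x * chs d (x # xs)"
    by (subst sum.reindex) (simp_all add: chs_def sum_distrib_left)
  also have "sum ?f (map Suc ` ?I (Suc d) ?n) = chs (Suc d) xs"
    by (subst sum.reindex) (simp_all add: chs_def o_def inj_on_def)
  finally show ?thesis .
qed

lemma chs_uminus: "chs d (map uminus xs) = (-1) ^ d * chs d xs"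
proof -
  have "(\<Prod>i\<leftarrow>is. map uminus xs ! i) = (-1) ^ length is * (\<Prod>i\<leftarrow>is. xs ! i)"
    if "set is \<subseteq> {..<length xs}" for "is"
    using that by (induction "is") auto
  thus ?thesis
    by (auto simp: chs_def sum_distrib_left intro!: sum.cong)
qed

text \<open>By \<open>chs_Suc_Cons\<close>, multiplication by 1 - xt deletes \<open>x\<close> from
  the generating function.\<close>

lemma chs_generating_function: "fps_of_poly (recip_poly xs) * Abs_fps (\<lambda>d. chs d xs) = 1"
proof (induction xs)
  case Nil
  have "chs d [] = (if d = 0 then 1 else 0)" for d by (cases d) auto
  thus ?case by (simp add: fps_eq_iff)
next
  case (Cons x xs)
  have "fps_of_poly [:1, -x:] * Abs_fps (\<lambda>d. chs d (x # xs)) = Abs_fps (\<lambda>d. chs d xs)"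
  proof (rule fps_ext)
    fix d
    show "fps_nth (fps_of_poly [:1, -x:] * Abs_fps (\<lambda>d. chs d (x # xs))) d = fps_nth (Abs_fps (\<lambda>d. chs d xs)) d"
      by (cases d) (simp_all add: fps_of_poly_linear' ring_distribs mult.assoc chs_Suc_Cons)
  qed
  thus ?case using Cons by (simp only: recip_poly_Cons fps_of_poly_mult mult_ac)
qed

text \<open>Over the common denominator \<open>R = recip_poly xs * recip_poly (map uminus xs)\<close>, twice the even part
  of the generating function has numerator \<open>recip_poly xs + recip_poly (map uminus xs)\<close>, of degree at
  most half that of \<open>R\<close>. Hence agreement in almost all even degrees forces agreement in all of them,
  and so no information about the degrees 2 and 4 is needed.\<close>

lemma recip_poly_eq_or_eq_uminus:
  assumes abs: "image_mset abs (mset xs) = image_mset abs (mset ys)"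
    and chs: "\<And>d. even d \<Longrightarrow> N \<le> d \<Longrightarrow> chs d xs = chs d ys"
  shows "recip_poly xs = recip_poly ys \<or> recip_poly xs = recip_poly (map uminus ys)"
proof -
  let ?P = "recip_poly xs" and ?P' = "recip_poly (map uminus xs)"
  let ?Q = "recip_poly ys" and ?Q' = "recip_poly (map uminus ys)"
  let ?h = "\<lambda>zs. Abs_fps (\<lambda>d. chs d zs)"
  have R: "?P * ?P' = ?Q * ?Q'"
    unfolding recip_poly_mult_uminus abs ..
  \<comment> \<open>Twice the even part of the difference of the two generating functions.\<close>
  define S where "S = ?h xs + ?h (map uminus xs) - ?h ys - ?h (map uminus ys)"
  have S_nth: "fps_nth S d = (if even d then 2 * (chs d xs - chs d ys) else 0)" for d
    by (simp add: S_def chs_uminus)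
  \<comment> \<open>Agreement from degree \<open>N\<close> on makes the series \<open>S\<close> a
    polynomial.\<close>
  define C where "C = truncate_fps N S"
  have SC: "S = fps_of_poly C"
    unfolding C_def fps_of_poly_truncate
    by (rule fps_ext) (auto simp: S_nth chs not_less)
  \<comment> \<open>Since \<open>chs 0\<close> is always 1, \<open>C\<close> has no constant term.
    This excludes the one case that the degree comparison below leaves open, a nonzero constant
    \<open>C\<close>.\<close>
  have C0: "coeff C 0 = 0"
    using S_nth[of 0] by (simp add: SC)
  have part: "fps_of_poly (recip_poly zs * recip_poly (map uminus zs)) * (?h zs + ?h (map uminus zs))
      = fps_of_poly (recip_poly zs + recip_poly (map uminus zs))" for zs
  proof -
    let ?F = "fps_of_poly (recip_poly zs)" and ?F' = "fps_of_poly (recip_poly (map uminus zs))"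
    have "?F * ?F' * (?h zs + ?h (map uminus zs)) = ?F' * (?F * ?h zs) + ?F * (?F' * ?h (map uminus zs))"
      by (simp add: algebra_simps)
    thus ?thesis
      by (simp add: chs_generating_function fps_of_poly_mult fps_of_poly_add)
  qed
  have "fps_of_poly (?P * ?P' * C) = fps_of_poly (?P + ?P') - fps_of_poly (?Q + ?Q')"
    unfolding part[symmetric] fps_of_poly_mult[of _ C] SC[symmetric] S_def R
    by (simp add: algebra_simps)
  hence PC: "?P * ?P' * C = ?P + ?P' - (?Q + ?Q')"
    by (simp only: fps_of_poly_diff[symmetric] fps_of_poly_eq_iff)
  have deg2: "degree (?P * ?P') = 2 * degree ?P" "degree (?Q * ?Q') = 2 * degree ?Q"
    by (simp_all add: degree_mult_eq degree_recip_poly_uminus)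
  hence degQ: "degree ?Q = degree ?P" using R by simp
  have "C = 0"
  proof (rule ccontr)
    assume "C \<noteq> 0"
    hence "degree (?P * ?P' * C) = 2 * degree ?P + degree C"
      using deg2 by (simp add: degree_mult_eq)
    moreover have "degree (?P + ?P' - (?Q + ?Q')) \<le> degree ?P"
      by (intro degree_diff_le degree_add_le) (simp_all add: degree_recip_poly_uminus degQ)
    ultimately have "degree C = 0" using PC by simp
    with C0 \<open>C \<noteq> 0\<close> show False by (metis leading_coeff_0_iff)
  qed
  hence sum: "?P' = ?Q + ?Q' - ?P" using PC by (simp add: algebra_simps)
  \<comment> \<open>The pairs \<open>?P\<close>, \<open>?P'\<close> and \<open>?Q\<close>,
    \<open>?Q'\<close> have the same sum and the same product, so \<open>?P\<close> is a root of (X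
    - \<open>?Q\<close>)(X - \<open>?Q'\<close>) over an integral domain.\<close>
  have "(?P - ?Q) * (?P - ?Q') = 0"
    using R unfolding sum by (simp add: algebra_simps)
  thus ?thesis by auto
qed

section \<open>Power sums\<close>

lemma sum_mset_poly_eqI:
  fixes M N :: "'a :: comm_ring_1 multiset"
  assumes "\<And>k. (\<Sum>x\<in>#M. x ^ k) = (\<Sum>x\<in>#N. x ^ k)"
  shows "(\<Sum>x\<in>#M. poly p x) = (\<Sum>x\<in>#N. poly p x)"
proof -
  have "(\<Sum>x\<in>#L. poly p x) = (\<Sum>i\<le>degree p. coeff p i * (\<Sum>x\<in>#L. x ^ i))" for L
    by (induction L) (simp_all add: poly_altdef sum.distrib ring_distribs)
  thus ?thesis by (simp only: assms)
qed

text \<open>Equal power sums give equal sums of any polynomial. One that vanishes at every other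
  element of \<open>M\<close> and \<open>N\<close>, but not at \<open>a\<close>, isolates the
  multiplicity of \<open>a\<close>.\<close>

lemma mset_eq_of_power_sums_eq:
  fixes M N :: "'a :: field_char_0 multiset"
  assumes "\<And>k. (\<Sum>x\<in>#M. x ^ k) = (\<Sum>x\<in>#N. x ^ k)"
  shows "M = N"
proof (rule multiset_eqI)
  fix a
  define T where "T = (set_mset M \<union> set_mset N) - {a}"
  define p where "p = (\<Prod>t\<in>T. [:-t, 1:])"
  have "finite T" by (simp add: T_def)
  hence pT: "poly p x = 0" if "x \<in> T" for x
    using that by (auto simp: p_def poly_prod)
  have pa: "poly p a \<noteq> 0"
    using \<open>finite T\<close> by (auto simp: p_def poly_prod T_def)
  have "(\<Sum>x\<in>#L. poly p x) = of_nat (count L a) * poly p a" if "set_mset L \<subseteq> insert a T" for L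
    using that by (induction L) (auto simp: ring_distribs pT)
  moreover have "set_mset M \<subseteq> insert a T" "set_mset N \<subseteq> insert a T" by (auto simp: T_def)
  ultimately have "of_nat (count M a) * poly p a = of_nat (count N a) * poly p a"
    using sum_mset_poly_eqI[OF assms, of p] by metis
  thus "count M a = count N a" using pa by simp
qed

section \<open>Spectra of powers of a matrix\<close>

lemma monic_poly_eq_prod_proots:
  fixes p :: "'a :: field poly"
  assumes "lead_coeff p = 1" and "size (proots p) = degree p" and "mset xs = proots p"
  shows "p = (\<Prod>x\<leftarrow>xs. [:-x, 1:])"
  using assms
proof (induction xs arbitrary: p)
  case Nil
  thus ?case using monic_degree_0[of p] by simp
next
  case (Cons x xs)
  have nz: "p \<noteq> 0" using Cons.prems(1) by auto
  have "x \<in># proots p" using Cons.prems(3) by (metis list.set_intros(1) set_mset_mset)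
  hence "poly p x = 0" using nz by simp
  then obtain q where q: "p = [:-x, 1:] * q" by (auto simp: poly_eq_0_iff_dvd elim: dvdE)
  have q0: "q \<noteq> 0" using nz q by auto
  have "proots p = {#x#} + proots q" unfolding q using q0 by (subst proots_mult) auto
  moreover have "degree p = Suc (degree q)" unfolding q using q0 by (subst degree_mult_eq) auto
  moreover have "lead_coeff q = 1" using Cons.prems(1) unfolding q lead_coeff_mult by simp
  ultimately have "q = (\<Prod>x\<leftarrow>xs. [:-x, 1:])"
    using Cons.prems by (intro Cons.IH) auto
  thus ?case by (simp add: q)
qed

text \<open>The term A(i,k) B(k,j) vanishes unless i \<le> k \<le> j; for i = j only k = i
  remains.\<close>

lemma upper_triangular_mult:
  fixes A B :: "'a :: semiring_0 mat"
  assumes A: "A \<in> carrier_mat n n" "upper_triangular A" and B: "B \<in> carrier_mat n n" "upper_triangular B"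
  shows "upper_triangular (A * B)" "i < n \<Longrightarrow> (A * B) $$ (i, i) = A $$ (i, i) * B $$ (i, i)"
proof -
  have entry: "(A * B) $$ (i, j) = (\<Sum>k<n. A $$ (i, k) * B $$ (k, j))" if "i < n" "j < n" for i j
    using that A B by (simp add: scalar_prod_def lessThan_atLeast0)
  have zero: "A $$ (i, k) * B $$ (k, j) = 0" if "i < n" "k < n" "j < i \<or> j = i \<and> k \<noteq> i" for i j k
  proof (cases "k < i")
    case True
    thus ?thesis using upper_triangularD[OF A(2) True] A that by simp
  next
    case False
    hence "j < k" using that by auto
    thus ?thesis using upper_triangularD[OF B(2) \<open>j < k\<close>] B that by simp
  qed
  show "upper_triangular (A * B)"
    using A B by (intro upper_triangularI) (auto simp: entry zero intro!: sum.neutral simp del: index_mult_mat(1))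
  show "(A * B) $$ (i, i) = A $$ (i, i) * B $$ (i, i)" if i: "i < n"
    using i by (subst entry) (auto simp: zero sum.remove[of "{..<n}" i])
qed

lemma upper_triangular_pow:
  fixes A :: "'a :: semiring_1 mat"
  assumes A: "A \<in> carrier_mat n n" "upper_triangular A"
  shows "upper_triangular (A ^\<^sub>m k)" and "diag_mat (A ^\<^sub>m k) = map (\<lambda>x. x ^ k) (diag_mat A)"
proof -
  have "upper_triangular (A ^\<^sub>m k) \<and> (\<forall>i<n. (A ^\<^sub>m k) $$ (i, i) = A $$ (i, i) ^ k)"
  proof (induction k)
    case 0
    thus ?case using A by simp
  next
    case (Suc k)
    thus ?case using upper_triangular_mult[OF pow_carrier_mat[OF A(1), of k] _ A]
      by (simp add: power_Suc2 del: power_Suc)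
  qed
  thus "upper_triangular (A ^\<^sub>m k)" "diag_mat (A ^\<^sub>m k) = map (\<lambda>x. x ^ k) (diag_mat A)"
    using A by (auto simp: diag_mat_def)
qed

section \<open>Traces under similarity\<close>

lemma trace_mult_commute:
  fixes A B :: "'a :: comm_semiring_0 mat"
  assumes "A \<in> carrier_mat n m" "B \<in> carrier_mat m n"
  shows "sum_list (diag_mat (A * B)) = sum_list (diag_mat (B * A))"
proof -
  have "sum_list (diag_mat (A * B)) = (\<Sum>i<n. \<Sum>j<m. A $$ (i, j) * B $$ (j, i))"
    using assms by (simp add: diag_mat_def scalar_prod_def interv_sum_list_conv_sum_set_nat lessThan_atLeast0)
  also have "\<dots> = (\<Sum>j<m. \<Sum>i<n. B $$ (j, i) * A $$ (i, j))"
    by (subst sum.swap) (simp add: mult.commute)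
  also have "\<dots> = sum_list (diag_mat (B * A))"
    using assms by (simp add: diag_mat_def scalar_prod_def interv_sum_list_conv_sum_set_nat lessThan_atLeast0)
  finally show ?thesis .
qed

lemma trace_similar:
  fixes A B :: "'a :: comm_ring_1 mat"
  assumes "similar_mat_wit A B P Q"
  shows "sum_list (diag_mat A) = sum_list (diag_mat B)"
proof -
  define n where "n = dim_row A"
  note wit = similar_mat_witD[OF n_def assms]
  have "sum_list (diag_mat A) = sum_list (diag_mat (P * (B * Q)))"
    using wit by (simp add: assoc_mult_mat[of P n n B n Q n])
  also have "\<dots> = sum_list (diag_mat (B * Q * P))"
    using wit by (intro trace_mult_commute) auto
  also have "B * Q * P = B"
    using wit by (simp add: assoc_mult_mat[of B n n Q n P n])
  finally show ?thesis .
qed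

lemma proots_linear_factors: "proots (\<Prod>x\<leftarrow>xs. [:-x, 1:]) = mset (xs :: 'a :: idom list)"
proof (induction xs)
  case (Cons x xs)
  have "proots ([:-x, 1:] * (\<Prod>x\<leftarrow>xs. [:-x, 1:])) = {#x#} + mset xs"
    by (subst proots_mult) (auto simp: prod_list_zero_iff Cons.IH simp del: mult_pCons_left)
  thus ?case by (simp del: mult_pCons_left)
qed simp

text \<open>Symmetry makes the characteristic polynomial split over the reals. Schur
  triangularisation then carries both claims to a triangular matrix, whose powers have the powers of
  the eigenvalues on the diagonal.\<close>

lemma symmetric_spectrum_pow:
  assumes A: "A \<in> carrier_mat n n" and sym: "transpose_mat A = A"
  shows eigenvalues_mset_pow:
      "eigenvalues_mset (A ^\<^sub>m k) = image_mset (\<lambda>x. x ^ k) (eigenvalues_mset A)"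
    and trace_pow_eq_power_sum:
      "sum_list (diag_mat (A ^\<^sub>m k)) = (\<Sum>x\<in>#eigenvalues_mset A. x ^ k)"
proof -
  obtain es where es: "mset es = eigenvalues_mset A" using ex_mset by blast
  have cp: "char_poly A = (\<Prod>e\<leftarrow>es. [:-e, 1:])"
    using degree_monic_char_poly[OF A] size_eigenvalues_mset[OF A sym] es
    by (intro monic_poly_eq_prod_proots) (auto simp: eigenvalues_mset_def)
  obtain B P Q where "schur_decomposition A es = (B, P, Q)" by (metis prod_cases3)
  from schur_decomposition[OF A cp this]
  have wit: "similar_mat_wit A B P Q" and ut: "upper_triangular B" and dB: "diag_mat B = es" by auto
  have B: "B \<in> carrier_mat n n" using similar_mat_witD2[OF A wit] by auto
  note wit_k = similar_mat_wit_pow[OF wit, of k]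
  note ut_k = upper_triangular_pow[OF B ut, of k]
  have "char_poly (A ^\<^sub>m k) = char_poly (B ^\<^sub>m k)"
    using wit_k by (intro char_poly_similar) (auto simp: similar_mat_def)
  also have "\<dots> = (\<Prod>x\<leftarrow>map (\<lambda>x. x ^ k) es. [:-x, 1:])"
    using char_poly_upper_triangular[OF pow_carrier_mat[OF B] ut_k(1)] ut_k(2) dB by simp
  finally show "eigenvalues_mset (A ^\<^sub>m k) = image_mset (\<lambda>x. x ^ k) (eigenvalues_mset A)"
    by (simp only: eigenvalues_mset_def[of "A ^\<^sub>m k"] proots_linear_factors mset_map es)
  have "sum_list (diag_mat (A ^\<^sub>m k)) = sum_list (map (\<lambda>x. x ^ k) es)"
    using trace_similar[OF wit_k] ut_k(2) dB by simp
  thus "sum_list (diag_mat (A ^\<^sub>m k)) = (\<Sum>x\<in>#eigenvalues_mset A. x ^ k)"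
    by (simp add: es[symmetric] sum_mset_sum_list[symmetric])
qed

text \<open>The Gram matrix is the square of \<open>A\<close>, and the square root of x^2 is the
  absolute value of x.\<close>

lemma singular_values_mset_symmetric:
  assumes A: "A \<in> carrier_mat n n" and sym: "transpose_mat A = A"
  shows "singular_values_mset A = image_mset abs (eigenvalues_mset A)"
proof -
  have "transpose_mat A * A = A ^\<^sub>m 2" using A sym by (simp add: numeral_2_eq_2)
  thus ?thesis
    using eigenvalues_mset_pow[OF A sym, of 2]
    by (simp add: singular_values_mset_def multiset.map_comp o_def)
qed

lemma trace_pow_nonneg:
  fixes A :: "real mat"
  assumes A: "A \<in> carrier_mat n n" and nonneg: "\<And>i j. i < n \<Longrightarrow> j < n \<Longrightarrow> 0 \<le> A $$ (i, j)"
  shows "0 \<le> sum_list (diag_mat (A ^\<^sub>m k))"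
proof -
  have "0 \<le> (A ^\<^sub>m k) $$ (i, j)" if "i < n" "j < n" for i j
    using that
  proof (induction k arbitrary: i j)
    case 0
    thus ?case using A by simp
  next
    case (Suc k)
    thus ?case using A nonneg by (auto simp: scalar_prod_def intro!: sum_nonneg mult_nonneg_nonneg)
  qed
  thus ?thesis using A by (auto simp: diag_mat_def intro!: sum_list_nonneg)
qed

section \<open>Adjacency matrices\<close>

lemma mset_eigenvalues_list [simp]: "mset (eigenvalues_list A) = eigenvalues_mset A"
  by (simp add: eigenvalues_list_def)

lemma adjacency_matrix_carrier: "adjacency_matrix G vs \<in> carrier_mat (length vs) (length vs)"
  by (simp add: adjacency_matrix_def)

lemma transpose_adjacency_matrix:
  assumes "pair_graph G"
  shows "transpose_mat (adjacency_matrix G vs) = adjacency_matrix G vs"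
proof -
  interpret pair_graph G by fact
  show ?thesis
    by (rule eq_matI) (auto simp: adjacency_matrix_def dest: arcs_symmetric)
qed

text \<open>The power sum is the trace of the \<open>k\<close>-th power of a matrix with entries 0
  and 1; it counts closed walks of length \<open>k\<close>.\<close>

lemma power_sum_adjacency_nonneg:
  assumes "pair_graph G"
  shows "0 \<le> (\<Sum>x\<in>#eigenvalues_mset (adjacency_matrix G vs). x ^ k)"
  unfolding trace_pow_eq_power_sum[OF adjacency_matrix_carrier transpose_adjacency_matrix[OF assms], symmetric]
  by (rule trace_pow_nonneg[OF adjacency_matrix_carrier]) (auto simp: adjacency_matrix_def)

theorem theorem1p9:
  fixes G :: "'a pair_pre_digraph" and H :: "'b pair_pre_digraph"
    and vs :: "'a list" and us :: "'b list" and n :: nat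
  assumes "pair_graph G" and "pair_graph H"
    and "card (pverts G) = n" and "card (pverts H) = n"
    and "vertex_enum G vs" and "vertex_enum H us"
    and "singularly_cospectral (adjacency_matrix G vs) (adjacency_matrix H us)"
    and "\<not> cospectral (adjacency_matrix G vs) (adjacency_matrix H us)"
  shows "\<exists>d::nat. even d \<and> 6 \<le> d \<and> chs_norm d G vs \<noteq> chs_norm d H us"
proof (rule ccontr)
  assume contra: "\<not> ?thesis"
  let ?A = "adjacency_matrix G vs" and ?B = "adjacency_matrix H us"
  let ?M = "eigenvalues_mset ?A" and ?N = "eigenvalues_mset ?B"
  define xs ys where "xs = eigenvalues_list ?A" and "ys = eigenvalues_list ?B"
  have mset: "mset xs = ?M" "mset ys = ?N" by (simp_all add: xs_def ys_def)
  note A = adjacency_matrix_carrier[of G vs] transpose_adjacency_matrix[OF assms(1), of vs]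
  note B = adjacency_matrix_carrier[of H us] transpose_adjacency_matrix[OF assms(2), of us]
  have abs: "image_mset abs ?M = image_mset abs ?N"
    using assms(7) singular_values_mset_symmetric[OF A] singular_values_mset_symmetric[OF B]
    by (simp add: singularly_cospectral_def)
  have "size ?M = size ?N" using arg_cong[OF abs, of size] by simp
  hence len: "length xs = length ys" by (metis mset size_mset)
  \<comment> \<open>For \<open>d > 0\<close> the function \<open>root d\<close> is injective on all
    reals, negative ones included, so equal norms give equal values of \<open>chs\<close>.\<close>
  have "chs d xs = chs d ys" if "even d" "6 \<le> d" for d
    using contra that by (auto simp: chs_norm_def xs_def ys_def)
  with abs have "recip_poly xs = recip_poly ys \<or> recip_poly xs = recip_poly (map uminus ys)"
    by (intro recip_poly_eq_or_eq_uminus[of xs ys 6]) (simp_all add: mset)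
  hence "mset xs = mset ys \<or> mset xs = mset (map uminus ys)"
    using len recip_poly_inject by (metis length_map)
  moreover have "mset xs \<noteq> mset ys"
    using assms(8) by (simp add: mset cospectral_def)
  ultimately have neg: "?M = image_mset uminus ?N" by (simp add: mset)
  have "(\<Sum>x\<in>#?M. x ^ k) = (\<Sum>x\<in>#?N. x ^ k)" for k
  proof -
    have "(\<Sum>x\<in>#?N. (- x) ^ k) = (\<Sum>x\<in>#?N. (-1) ^ k * x ^ k)"
      by (rule arg_cong[where f = sum_mset], rule image_mset_cong) (rule power_minus)
    hence opp: "(\<Sum>x\<in>#?M. x ^ k) = (-1) ^ k * (\<Sum>x\<in>#?N. x ^ k)"
      by (simp add: neg multiset.map_comp o_def sum_mset_distrib_left)
    \<comment> \<open>For odd \<open>k\<close> the two nonnegative numbers are opposite, hence both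
      0.\<close>
    have "a = b" if "a = (-1) ^ k * b" "0 \<le> a" "0 \<le> b" for a b :: real
      using that by (cases "even k") auto
    from this[OF opp power_sum_adjacency_nonneg[OF assms(1)] power_sum_adjacency_nonneg[OF assms(2)]]
    show ?thesis .
  qed
  hence "?M = ?N" by (rule mset_eq_of_power_sums_eq)
  with assms(8) show False by (simp add: cospectral_def)
qed

end
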